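(* Let $p_1,q_1\ge 0$ be integers with $p_1\le q_1+1$, let $\mathbf{a}_1\in\mathbb{R}^{p_1}$, $\mathbf{b}_1\in\mathbb{R}^{q_1}$, where no component of $\mathbf{b}_1$ is a non-positive integer, and let $x\in\mathbb{R}$. Then the inequality $${}_{p_1}F_{q_1}(\mathbf{a}_1;\mathbf{b}_1;xt)\ge 0\quad\text{for all } t>0 \text{ if } p_1\le q_1,\ \text{ or for all } 0<t<1 \text{ if } p_1=q_1+1,$$ holds if any one of the following conditions is satisfied: A) either $x\ge0$ and $0\le p_1<q_1+1$, or $0\le x<1$ and $1\le p_1=q_1+1$; and $(\mathbf{a}_1)_n/(\mathbf{b}_1)_n>0$ for all integers $n\ge0$; B) $x<1$, $1\le p_1=q_1+1$, $\mathbf{a}_1'>0$ and $v_{\mathbf{a}_1',\mathbf{b}_1}(t)\ge0$ on $[0,1]$, where $\mathbf{a}_1'$ denotes $\mathbf{a}_1$ with its largest element removed; C) $x\in\mathbb{R}$, $p_1=q_1\ge0$, $\mathbf{a}_1>0$ and $v_{\mathbf{a}_1,\mathbf{b}_1}(t)\ge0$ on $[0,1]$; D) $x\in\mathbb{R}$, $1\le p_1=q_1-1$, $\mathbf{a}_1>0$, and, setting $\hat{\mathbf{a}}=(\mathbf{a}_1,3/2)$ and $\hat{\mathbf{b}}=\mathbf{b}_1$ (both of length $q_1$), there exist indices $k,s\in\{1,\dots,q_1\}$ such that $\hat a_k\le\min\{1,\hat b_s-1\}$ and $v_{\hat{\mathbf{a}}_{[k]},\hat{\mathbf{b}}_{[s]}}(t)\ge0$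 on $[0,1]$.
   Context: For parameter vectors $\mathbf{a}=(a_1,\dots,a_p)$ and $\mathbf{b}=(b_1,\dots,b_q)$ with no $b_j$ a non-positive integer, the generalized hypergeometric function is ${}_pF_q(\mathbf{a};\mathbf{b};z)=\sum_{n\ge0}\frac{(a_1)_n\cdots(a_p)_n}{(b_1)_n\cdots(b_q)_n\,n!}z^n$ for $z\in\mathbb{C}$ if $p\le q$. If $p=q+1$ the series converges in the open unit disk, and ${}_pF_q(z)$ denotes its analytic continuation to $\mathbb{C}\setminus[1,\infty)$. Here $(a)_n=a(a+1)\cdots(a+n-1)$ is the rising factorial, and $(\mathbf{a})_n=(a_1)_n\cdots(a_p)_n$. Vectors may be empty (empty products equal $1$, empty sums equal $0$; e.g. ${}_0F_0(z)=e^z$). $\mathbf{a}>0$ means every component is positive. $\mathbf{a}_{[k]}$ denotes the vector $\mathbf{a}$ with its $k$-th element removed. For two real vectors $\mathbf{a},\mathbf{b}$ of equal length $m$, $v_{\mathbf{a},\mathbf{b}}(t)=\sum_{k=1}^{m}(t^{a_k}-t^{b_k})$. *)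

theory Defs
  imports "HOL-Complex_Analysis.Complex_Analysis"
begin

definition pochhammer_list :: "'a::comm_semiring_1 list \<Rightarrow> nat \<Rightarrow> 'a" where
  "pochhammer_list as n = (\<Prod>a\<leftarrow>as. pochhammer a n)"

definition slit_plane :: "complex set" where
  "slit_plane = - (complex_of_real ` {1..})"

definition hypergeo_continuation ::
    "complex list \<Rightarrow> complex list \<Rightarrow> (complex \<Rightarrow> complex) \<Rightarrow> bool" where
  "hypergeo_continuation as bs f \<longleftrightarrow> f holomorphic_on slit_plane \<and>
     (\<forall>z\<in>ball 0 1. f z = eval_fps (fps_hypergeo as bs 1) z)"

text \<open>
  Where the series applies, the function is its sum; outside the open unit disk, for one
  more upper than lower parameter, it is the value of the analytic continuation to the plane
  slit along \<open>[1,\<infinity>)\<close>. The continuation exists by the classical theory of the hypergeometric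
  differential equation; that the choice does not matter on the slit plane is lemma
  \<open>hypergeo_eq_continuation\<close> below. The values are meaningless on \<open>[1,\<infinity>)\<close>, if the upper
  parameters exceed the lower ones by more than one, and if some lower parameter is a
  non-positive integer.
\<close>
definition hypergeo :: "complex list \<Rightarrow> complex list \<Rightarrow> complex \<Rightarrow> complex" where
  "hypergeo as bs z =
     (if length as \<le> length bs \<or> norm z < 1 then eval_fps (fps_hypergeo as bs 1) z
      else (SOME f. hypergeo_continuation as bs f) z)"

text \<open>
  Only meant for lists of equal length. At \<open>t = 0\<close> note that \<open>0 powr c = 0\<close> for all \<open>c\<close>;
  this is the usual value of the power when \<open>c > 0\<close>.
\<close>
definition v_fun :: "real list \<Rightarrow> real list \<Rightarrow> real \<Rightarrow> real" where
  "v_fun as bs t = (\<Sum>k<length as. t powr (as ! k) - t powr (bs ! k))"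

text \<open>Positions are counted from 0, as for \<open>(!)\<close>.\<close>
definition remove_nth :: "nat \<Rightarrow> 'a list \<Rightarrow> 'a list" where
  "remove_nth k xs = take k xs @ drop (Suc k) xs"

lemma pochhammer_list_eq_foldl:
  "foldl (\<lambda>r a. r * pochhammer a n) c as = c * pochhammer_list as n"
  by (induction as arbitrary: c) (simp_all add: pochhammer_list_def mult.assoc)

lemma eval_fps_hypergeo:
  "eval_fps (fps_hypergeo as bs 1) z =
     (\<Sum>n. pochhammer_list as n / (pochhammer_list bs n * fact n) * z ^ n)"
  by (simp add: eval_fps_def pochhammer_list_eq_foldl)

lemma open_slit_plane: "open slit_plane"
proof -
  have "complex_of_real ` {1..} = {z. Im z = 0} \<inter> {z. Re z \<ge> 1}"
    by (auto simp: image_iff complex_eq_iff)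
  moreover have "closed ({z. Im z = 0} \<inter> {z. Re z \<ge> 1})"
    by (intro closed_Int closed_halfspace_Re_ge)
       (simp add: closed_Collect_eq continuous_on_Im)
  ultimately have "closed (complex_of_real ` {1..})"
    by (simp only:)
  then show ?thesis
    unfolding slit_plane_def by (rule open_Compl)
qed

lemma starlike_slit_plane: "starlike slit_plane"
  unfolding starlike_def
proof (intro bexI ballI subsetI)
  show "0 \<in> slit_plane"
    by (auto simp: slit_plane_def)
next
  fix w z
  assume w: "w \<in> slit_plane" and "z \<in> closed_segment 0 w"
  then obtain u where u: "0 \<le> u" "u \<le> 1" "z = of_real u * w"
    by (auto simp: in_segment scaleR_conv_of_real)
  show "z \<in> slit_plane"
  proof (rule ccontr)
    assume "z \<notin> slit_plane"
    then obtain r where r: "r \<ge> 1" "of_real u * w = of_real r"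
      using u by (auto simp: slit_plane_def)
    with u have "u > 0"
      by (cases "u = 0") auto
    with r have "w = of_real (r / u)"
      by (simp add: field_simps)
    moreover have "r / u \<ge> 1"
      using r u \<open>u > 0\<close> by (simp add: field_simps)
    ultimately show False
      using w unfolding slit_plane_def by blast
  qed
qed

lemma ball_subset_slit_plane: "ball 0 1 \<subseteq> slit_plane"
  by (auto simp: slit_plane_def)

lemma hypergeo_continuation_unique:
  assumes "hypergeo_continuation as bs f" "hypergeo_continuation as bs g" "z \<in> slit_plane"
  shows "f z = g z"
  by (rule analytic_continuation_open[of "ball 0 1" slit_plane f g])
     (use assms ball_subset_slit_plane open_slit_plane starlike_slit_plane
      in \<open>auto simp: hypergeo_continuation_def starlike_imp_connected\<close>)

lemma hypergeo_eq_continuation: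
  assumes "hypergeo_continuation as bs f" "length as = length bs + 1" "z \<in> slit_plane"
  shows "hypergeo as bs z = f z"
proof (cases "norm z < 1")
  case True
  with assms show ?thesis
    by (simp add: hypergeo_def hypergeo_continuation_def)
next
  case False
  have "hypergeo_continuation as bs (SOME f. hypergeo_continuation as bs f)"
    using assms(1) by (rule someI[of "hypergeo_continuation as bs"])
  with False assms show ?thesis
    by (auto simp: hypergeo_def intro: hypergeo_continuation_unique)
qed

end

theory Submission
  imports Defs "HOL-Probability.Distributions" "HOL-Real_Asymp.Real_Asymp"
begin

text \<open>
  Condition A makes all terms of the series nonnegative, so that only its convergence is needed. The
  other three conditions rest on one fact: if \<open>\<^bold>a\<close> and \<open>\<^bold>b\<close> have equal length, \<open>\<^bold>a > 0\<close> and
  \<open>v \<ge> 0\<close> on \<open>[0,1]\<close>, then \<open>m\<^sub>n = (\<^bold>a)\<^sub>n / (\<^bold>b)\<^sub>n\<close> is completely monotone, that is, a Hausdorff moment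
  sequence on \<open>[0,1]\<close> (\<open>completely_monotone_pochhammer_ratio\<close>). The reason is that
  \<open>R(s) = \<Prod> (b + s) / (a + s)\<close> has logarithmic derivative \<open>- h\<close>, where \<open>h\<close> is the Laplace transform of
  \<open>v(e\<^sup>-\<^sup>u)\<close>; hence \<open>R\<close> is a completely monotone function, and \<open>m\<^sub>n\<close> is a limit of products of shifts
  of \<open>R\<close>.

  Consequently \<open>\<Sum> c\<^sub>n m\<^sub>n z\<^sup>n\<close> is an average of \<open>g(z t)\<close> over \<open>t \<in> [0,1]\<close>, where \<open>g(y) = \<Sum> c\<^sub>n y\<^sup>n\<close>,
  and it is nonnegative if \<open>g\<close> is nonnegative on the segment from 0 to \<open>z\<close>. Instead of a measure, the
  proof uses the quadrature with the nodes \<open>k / N\<close> and the weights obtained from Bernstein polynomials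
  (\<open>bernstein_functional_tendsto\<close>): the weights are nonnegative, and their moments tend to \<open>m\<close>.

  The kernel \<open>g\<close> depends on the condition. For C it is the exponential function. For B it is
  \<open>(1 - y)\<^sup>-\<^sup>\<alpha>\<close> with \<open>\<alpha>\<close> the largest upper parameter; here the quadratures also have to be followed
  outside the unit disk, where Montel's theorem shows that they produce the analytic continuation
  (\<open>binomial_kernel_continuation\<close>). For D it is \<open>\<^sub>1F\<^sub>2(1; 3/2, 2; y)\<close>, which for \<open>y = - x\<^sup>2\<close> equals
  \<open>(sin x / x)\<^sup>2\<close>. The hypothesis on \<open>k\<close> and \<open>s\<close> keeps \<open>v\<close> nonnegative when
  \<open>(\<^bold>a, 3/2, 2)\<close> is compared with \<open>(\<^bold>b, 1)\<close> (\<open>extended_v_fun_nonneg\<close>).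
\<close>

section \<open>Completely monotone functions\<close>

text \<open>
  The usual sign condition \<open>(-1)\<^sup>j f\<^sup>(\<^sup>j\<^sup>) \<ge> 0\<close> for \<open>j \<le> n\<close> on \<open>[0,\<infinity>)\<close>, written so that no higher
  derivative is ever named: \<open>g\<close> is \<open>- f'\<close>, and it has to satisfy the condition up to \<open>n - 1\<close>. The
  closure properties then follow by induction on \<open>n\<close>, without binomial sums of derivatives.
\<close>
primrec cm_upto :: "nat \<Rightarrow> (real \<Rightarrow> real) \<Rightarrow> bool" where
  "cm_upto 0 f \<longleftrightarrow> (\<forall>s\<ge>0. f s \<ge> 0)"
| "cm_upto (Suc n) f \<longleftrightarrow> (\<forall>s\<ge>0. f s \<ge> 0) \<and>
     (\<exists>g. cm_upto n g \<and> (\<forall>s\<ge>0. (f has_real_derivative - g s) (at s)))"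

lemma cm_upto_nonneg: "cm_upto n f \<Longrightarrow> s \<ge> 0 \<Longrightarrow> f s \<ge> 0"
  by (cases n) auto

lemma cm_upto_SucI:
  assumes "\<And>s. s \<ge> 0 \<Longrightarrow> f s \<ge> 0" "cm_upto n g"
    and "\<And>s. s \<ge> 0 \<Longrightarrow> (f has_real_derivative - g s) (at s)"
  shows "cm_upto (Suc n) f"
  using assms by auto

lemma cm_upto_SucE:
  assumes "cm_upto (Suc n) f"
  obtains g where "cm_upto n g" "\<And>s. s \<ge> 0 \<Longrightarrow> (f has_real_derivative - g s) (at s)"
  using assms by auto

declare cm_upto.simps(2) [simp del]

lemma cm_upto_Suc_imp: "cm_upto (Suc n) f \<Longrightarrow> cm_upto n f"
proof (induction n arbitrary: f)
  case (Suc n)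
  obtain g where "cm_upto (Suc n) g" "\<And>s. s \<ge> 0 \<Longrightarrow> (f has_real_derivative - g s) (at s)"
    using Suc.prems by (rule cm_upto_SucE) blast
  then show ?case
    by (intro cm_upto_SucI[OF cm_upto_nonneg[OF Suc.prems] Suc.IH])
qed (auto intro: cm_upto_nonneg)

lemma cm_upto_add: "cm_upto n f \<Longrightarrow> cm_upto n g \<Longrightarrow> cm_upto n (\<lambda>s. f s + g s)"
proof (induction n arbitrary: f g)
  case (Suc n)
  obtain f' where f': "cm_upto n f'" "\<And>s. s \<ge> 0 \<Longrightarrow> (f has_real_derivative - f' s) (at s)"
    using Suc.prems(1) by (rule cm_upto_SucE) blast
  obtain g' where g': "cm_upto n g'" "\<And>s. s \<ge> 0 \<Longrightarrow> (g has_real_derivative - g' s) (at s)"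
    using Suc.prems(2) by (rule cm_upto_SucE) blast
  show ?case
  proof (rule cm_upto_SucI)
    show "cm_upto n (\<lambda>s. f' s + g' s)"
      by (intro Suc.IH f' g')
    show "((\<lambda>s. f s + g s) has_real_derivative - (f' s + g' s)) (at s)" if "s \<ge> 0" for s
      using f'(2)[OF that] g'(2)[OF that] by (auto intro!: derivative_eq_intros)
  qed (auto intro!: add_nonneg_nonneg Suc.prems[THEN cm_upto_nonneg])
qed auto

lemma cm_upto_mult: "cm_upto n f \<Longrightarrow> cm_upto n g \<Longrightarrow> cm_upto n (\<lambda>s. f s * g s)"
proof (induction n arbitrary: f g)
  case (Suc n)
  obtain f' where f': "cm_upto n f'" "\<And>s. s \<ge> 0 \<Longrightarrow> (f has_real_derivative - f' s) (at s)"
    using Suc.prems(1) by (rule cm_upto_SucE) blast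
  obtain g' where g': "cm_upto n g'" "\<And>s. s \<ge> 0 \<Longrightarrow> (g has_real_derivative - g' s) (at s)"
    using Suc.prems(2) by (rule cm_upto_SucE) blast
  show ?case
  proof (rule cm_upto_SucI)
    show "cm_upto n (\<lambda>s. f' s * g s + f s * g' s)"
      by (intro cm_upto_add Suc.IH f' g' Suc.prems[THEN cm_upto_Suc_imp])
    show "((\<lambda>s. f s * g s) has_real_derivative - (f' s * g s + f s * g' s)) (at s)"
      if "s \<ge> 0" for s
      using f'(2)[OF that] g'(2)[OF that]
      by (auto intro!: derivative_eq_intros simp: algebra_simps)
  qed (auto intro!: mult_nonneg_nonneg Suc.prems[THEN cm_upto_nonneg])
qed auto

lemma cm_upto_const: "c \<ge> 0 \<Longrightarrow> cm_upto n (\<lambda>_. c)"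
proof (induction n arbitrary: c)
  case (Suc n)
  then show ?case
    by (intro cm_upto_SucI[where g = "\<lambda>_. 0"]) auto
qed auto

lemma cm_upto_prod: "(\<And>i. i \<in> I \<Longrightarrow> cm_upto n (f i)) \<Longrightarrow> cm_upto n (\<lambda>s. \<Prod>i\<in>I. f i s)"
  by (induction I rule: infinite_finite_induct) (auto intro: cm_upto_const cm_upto_mult)

lemma cm_upto_shift: "cm_upto n f \<Longrightarrow> c \<ge> 0 \<Longrightarrow> cm_upto n (\<lambda>s. f (s + c))"
proof (induction n arbitrary: f)
  case (Suc n)
  obtain f' where f': "cm_upto n f'" "\<And>s. s \<ge> 0 \<Longrightarrow> (f has_real_derivative - f' s) (at s)"
    using Suc.prems(1) by (rule cm_upto_SucE) blast
  show ?case
  proof (rule cm_upto_SucI)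
    show "cm_upto n (\<lambda>s. f' (s + c))"
      by (rule Suc.IH[OF f'(1) Suc.prems(2)])
    show "((\<lambda>s. f (s + c)) has_real_derivative - f' (s + c)) (at s)" if "s \<ge> 0" for s
      using f'(2)[of "s + c"] that Suc.prems by (simp add: DERIV_shift)
  qed (use Suc.prems(2) in \<open>auto intro!: cm_upto_nonneg[OF Suc.prems(1)]\<close>)
qed auto

lemma cm_upto_antimono:
  assumes "cm_upto (Suc n) f" "s \<ge> 0"
  shows "f (s + 1) \<le> f s"
proof -
  obtain f' where f': "cm_upto n f'" "\<And>s. s \<ge> 0 \<Longrightarrow> (f has_real_derivative - f' s) (at s)"
    using assms(1) by (rule cm_upto_SucE) blast
  show ?thesis
  proof (rule DERIV_nonpos_imp_nonincreasing[of s "s + 1" f])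
    fix x assume "s \<le> x" "x \<le> s + 1"
    with assms(2) have "x \<ge> 0" by simp
    then show "\<exists>y. (f has_real_derivative y) (at x) \<and> y \<le> 0"
      using f'(2)[of x] cm_upto_nonneg[OF f'(1), of x] by (intro exI[of _ "- f' x"]) simp
  qed simp
qed

text \<open>
  The step \<open>-\<Delta>\<close> costs one order because its sign comes from the mean value theorem, while it commutes
  with differentiation.
\<close>
lemma cm_upto_forward_difference:
  "cm_upto (Suc n) f \<Longrightarrow> cm_upto n (\<lambda>s. f s - f (s + 1))"
proof (induction n arbitrary: f)
  case 0
  then show ?case
    using cm_upto_antimono[OF 0] by simp
next
  case (Suc n)
  obtain f' where f': "cm_upto (Suc n) f'" "\<And>s. s \<ge> 0 \<Longrightarrow> (f has_real_derivative - f' s) (at s)"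
    using Suc.prems by (rule cm_upto_SucE) blast
  have "f (s + 1) \<le> f s" if "s \<ge> 0" for s
    using Suc.prems that by (rule cm_upto_antimono)
  moreover have "((\<lambda>s. f s - f (s + 1)) has_real_derivative - (f' s - f' (s + 1))) (at s)"
    if "s \<ge> 0" for s
  proof -
    have "((\<lambda>s. f (s + 1)) has_real_derivative - f' (s + 1)) (at s)"
      using f'(2)[of "s + 1"] that by (simp add: DERIV_shift)
    with f'(2)[OF that] show ?thesis
      by (auto intro!: derivative_eq_intros)
  qed
  ultimately show ?case
    by (intro cm_upto_SucI[OF _ Suc.IH[OF f'(1)]]) simp_all
qed

section \<open>Completely monotone sequences\<close>

definition nabla :: "(nat \<Rightarrow> real) \<Rightarrow> nat \<Rightarrow> real" where
  "nabla m n = m n - m (Suc n)"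

text \<open>
  Hausdorff's condition for \<open>m\<close> to be the sequence of moments of a positive measure on \<open>[0,1]\<close>:
  integrating \<open>t\<^sup>n (1 - t)\<^sup>j\<close> gives \<open>(nabla ^^ j) m n\<close>. The measure itself is not constructed; positivity
  of these numbers is all that is used.
\<close>
definition completely_monotone :: "(nat \<Rightarrow> real) \<Rightarrow> bool" where
  "completely_monotone m \<longleftrightarrow> (\<forall>j n. (nabla ^^ j) m n \<ge> 0)"

lemma completely_monotone_of_cm_upto:
  assumes "\<And>j. cm_upto j f"
  shows "completely_monotone (\<lambda>n. f (real n))"
proof -
  have "cm_upto j f \<Longrightarrow> (nabla ^^ j) (\<lambda>n. f (real n)) n \<ge> 0" for j n
  proof (induction j arbitrary: f)
    case (Suc j)
    have "nabla (\<lambda>n. f (real n)) = (\<lambda>n. f (real n) - f (real n + 1))"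
      by (simp add: nabla_def fun_eq_iff algebra_simps)
    with Suc.IH[OF cm_upto_forward_difference[OF Suc.prems]] show ?case
      by (simp add: funpow_Suc_right del: funpow.simps)
  qed auto
  from this[OF assms] show ?thesis
    unfolding completely_monotone_def by (intro allI)
qed

lemma completely_monotone_limit:
  assumes "\<And>N. completely_monotone (u N)" "\<And>n. (\<lambda>N. u N n) \<longlonglongrightarrow> m n"
  shows "completely_monotone m"
proof -
  have "(\<lambda>N. (nabla ^^ j) (u N) n) \<longlonglongrightarrow> (nabla ^^ j) m n" for j n
  proof (induction j arbitrary: n)
    case (Suc j)
    show ?case
      using tendsto_diff[OF Suc.IH[of n] Suc.IH[of "Suc n"]] by (simp add: nabla_def)
  qed (use assms(2) in simp)
  moreover have "(nabla ^^ j) (u N) n \<ge> 0" for N j n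
    using assms(1) by (simp add: completely_monotone_def)
  ultimately have "(nabla ^^ j) m n \<ge> 0" for j n
    by (intro LIMSEQ_le_const[where X = "\<lambda>N. (nabla ^^ j) (u N) n"] exI[of _ 0]) auto
  then show ?thesis
    by (simp add: completely_monotone_def)
qed

section \<open>Ratios of rising factorials\<close>

lemma has_bochner_integral_power_times_exp:
  assumes "c > (0 :: real)"
  shows "has_bochner_integral lborel
           (\<lambda>t. indicator {0..} t * (t ^ k * exp (- c * t))) (fact k / c ^ Suc k)"
proof -
  have "has_bochner_integral lborel (erlang_density k c) 1"
    using nn_integral_erlang_ith_moment[OF assms, of k 0] assms
    by (intro has_bochner_integral_nn_integral) auto
  from has_bochner_integral_mult_right[OF this, of "fact k / c ^ Suc k"]
  have "has_bochner_integral lborel (\<lambda>t. fact k / c ^ Suc k * erlang_density k c t)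
          (fact k / c ^ Suc k)" by simp
  also have "(\<lambda>t. fact k / c ^ Suc k * erlang_density k c t) =
      (\<lambda>t. indicator {0..} t * (t ^ k * exp (- c * t)))"
    using assms by (auto simp: erlang_density_def fun_eq_iff indicator_def)
  finally show ?thesis .
qed

text \<open>
  With \<open>t = e\<^sup>-\<^sup>u\<close> the function \<open>v\<close> becomes \<open>\<Sum> e\<^sup>-\<^sup>a\<^sup>u - e\<^sup>-\<^sup>b\<^sup>u\<close>, so the sum below is the Laplace transform at
  \<open>s\<close> of the nonnegative function \<open>u\<^sup>j v(e\<^sup>-\<^sup>u)\<close>.
\<close>
lemma laplace_v_fun_nonneg:
  assumes "length as = length bs" "\<And>a. a \<in> set as \<Longrightarrow> a > 0" "\<And>b. b \<in> set bs \<Longrightarrow> b > 0"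
    and v: "\<And>t. t \<in> {0..1} \<Longrightarrow> v_fun as bs t \<ge> 0" and "s \<ge> 0"
  shows "(\<Sum>k<length as. fact j / (as ! k + s) ^ Suc j - fact j / (bs ! k + s) ^ Suc j) \<ge> 0"
proof -
  let ?e = "\<lambda>c t. indicator {0..} t * (t ^ j * exp (- c * t)) :: real"
  have *: "has_bochner_integral lborel
     (\<lambda>t. \<Sum>k<length as. ?e (as ! k + s) t - ?e (bs ! k + s) t)
     (\<Sum>k<length as. fact j / (as ! k + s) ^ Suc j - fact j / (bs ! k + s) ^ Suc j)"
    using assms
    by (intro has_bochner_integral_sum has_bochner_integral_diff
          has_bochner_integral_power_times_exp) (auto simp: add_pos_nonneg)
  have "(\<Sum>k<length as. ?e (as ! k + s) t - ?e (bs ! k + s) t) \<ge> 0" for t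
  proof (cases "t \<ge> 0")
    case True
    have "exp (- (a + s) * t) = exp (- s * t) * exp (- t) powr a" for a
      by (simp add: powr_def mult_exp_exp algebra_simps)
    then have "?e (a + s) t = t ^ j * exp (- s * t) * exp (- t) powr a" for a
      using True by simp
    then have "(\<Sum>k<length as. ?e (as ! k + s) t - ?e (bs ! k + s) t) =
        t ^ j * exp (- s * t) * v_fun as bs (exp (- t))"
      by (simp only: v_fun_def sum_distrib_left right_diff_distrib)
    with True show ?thesis
      using v[of "exp (- t)"] by simp
  qed auto
  then show ?thesis
    unfolding has_bochner_integral_integral_eq[OF *, symmetric] by (rule Bochner_Integration.integral_nonneg)
qed

text \<open>
  As \<open>t\<close> tends to 0, the powers with exponents \<open>a\<close> vanish, while a single exponent \<open>b \<le> 0\<close> would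
  contribute at least 1 with a minus sign.
\<close>
lemma v_fun_nonneg_imp_pos:
  assumes "length as = length bs" "\<And>a. a \<in> set as \<Longrightarrow> a > 0"
    and v: "\<And>t. t \<in> {0..1} \<Longrightarrow> v_fun as bs t \<ge> 0" and "b \<in> set bs"
  shows "b > 0"
proof (rule ccontr)
  assume "\<not> b > 0"
  obtain k where k: "k < length bs" "bs ! k = b"
    using \<open>b \<in> set bs\<close> by (auto simp: in_set_conv_nth)
  have "((\<lambda>t::real. \<Sum>k<length as. t powr (as ! k)) \<longlongrightarrow> (\<Sum>k<length as. 0)) (at_right 0)"
  proof (rule tendsto_sum)
    fix k assume "k \<in> {..<length as}"
    then have "as ! k > 0" using assms(2) by auto
    then show "((\<lambda>t::real. t powr (as ! k)) \<longlongrightarrow> 0) (at_right 0)"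
      by (intro tendsto_zero_powrI[of _ _ _ "as ! k"] tendsto_const tendsto_ident_at
            eventually_at_right_less[THEN eventually_mono]) auto
  qed
  then have "\<forall>\<^sub>F t in at_right (0::real). (\<Sum>k<length as. t powr (as ! k)) < 1"
    by (intro order_tendstoD) auto
  moreover have "\<forall>\<^sub>F t in at_right (0::real). t \<in> {0<..<1}"
    by (rule eventually_at_right_real) simp
  ultimately have "\<forall>\<^sub>F t in at_right (0::real). False"
  proof eventually_elim
    case (elim t)
    have "1 \<le> t powr b"
      using elim \<open>\<not> b > 0\<close> by (simp add: powr_def mult_nonpos_nonpos)
    also have "\<dots> \<le> (\<Sum>k<length as. t powr (bs ! k))"
      using k assms(1) by (intro member_le_sum[of k, where f = "\<lambda>k. t powr (bs ! k)", unfolded k]) auto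
    finally show False
      using elim v[of t] by (auto simp: v_fun_def sum_subtractf)
  qed
  then show False by simp
qed

text \<open>
  The exponential is \<open>R(s) = \<Prod> (b + s) / (a + s)\<close>, and \<open>- R' / R = h\<close> with \<open>h(s) = \<Sum> 1 / (a + s) - 1 / (b + s)\<close>.
  All derivatives of \<open>h\<close> have the right sign by the Laplace representation, and \<open>R' = - h R\<close> passes the
  condition from order \<open>n\<close> to order \<open>n + 1\<close>.
\<close>
lemma cm_upto_shift_ratio:
  assumes len: "length as = length bs" and a: "\<And>a. a \<in> set as \<Longrightarrow> a > 0"
    and v: "\<And>t. t \<in> {0..1} \<Longrightarrow> v_fun as bs t \<ge> 0"
  shows "cm_upto n (\<lambda>s. exp (\<Sum>k<length as. ln (bs ! k + s) - ln (as ! k + s)))"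
    (is "cm_upto n ?R")
proof -
  have pos: "as ! k + s > 0" "bs ! k + s > 0" if "k < length as" "s \<ge> 0" for k s
    using that a v_fun_nonneg_imp_pos[OF assms] len by (simp_all add: add_pos_nonneg)
  \<comment> \<open>\<open>h j\<close> is \<open>(-1)\<^sup>j\<close> times the \<open>j\<close>-th derivative of \<open>h 0\<close>, and \<open>h 0\<close> is \<open>- R' / R\<close>.\<close>
  define h where "h j s =
    (\<Sum>k<length as. fact j / (as ! k + s) ^ Suc j - fact j / (bs ! k + s) ^ Suc j)" for j s
  have h_nonneg: "h j s \<ge> 0" if "s \<ge> 0" for j s
    unfolding h_def using v_fun_nonneg_imp_pos[OF assms] that
    by (intro laplace_v_fun_nonneg assms(1,3)) (use a in auto)
  have h_deriv: "(h j has_real_derivative - h (Suc j) s) (at s)" if "s \<ge> 0" for j s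
  proof -
    have pow: "((\<lambda>s. fact j / (c + s) ^ Suc j) has_real_derivative
             - (fact (Suc j) / (c + s) ^ Suc (Suc j))) (at s)" if "c + s > 0" for c
    proof -
      have "((\<lambda>s. (c + s) ^ Suc j) has_real_derivative real (Suc j) * (c + s) ^ j) (at s)"
        by (auto intro!: derivative_eq_intros simp del: power_Suc)
      from DERIV_divide[OF DERIV_const[of "fact j"] this] that
      have "((\<lambda>s. fact j / (c + s) ^ Suc j) has_real_derivative
          (0 * (c + s) ^ Suc j - fact j * (real (Suc j) * (c + s) ^ j)) /
            ((c + s) ^ Suc j * (c + s) ^ Suc j)) (at s)"
        by simp
      also have "(0 * y ^ Suc j - fact j * (real (Suc j) * y ^ j)) / (y ^ Suc j * y ^ Suc j) =
          - (fact (Suc j) / y ^ Suc (Suc j))" if "y > 0" for y :: real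
        using that by (simp add: divide_simps)
      note this[OF that]
      finally show ?thesis .
    qed
    have "((\<lambda>s. \<Sum>k<length as. fact j / (as ! k + s) ^ Suc j - fact j / (bs ! k + s) ^ Suc j)
        has_real_derivative
          (\<Sum>k<length as. - (fact (Suc j) / (as ! k + s) ^ Suc (Suc j))
             - - (fact (Suc j) / (bs ! k + s) ^ Suc (Suc j)))) (at s)"
      using pos that by (intro DERIV_sum DERIV_diff pow) auto
    also have "(\<Sum>k<length as. - (fact (Suc j) / (as ! k + s) ^ Suc (Suc j))
             - - (fact (Suc j) / (bs ! k + s) ^ Suc (Suc j))) = - h (Suc j) s"
      unfolding h_def sum_negf[symmetric] by (intro sum.cong) auto
    finally show ?thesis
      unfolding h_def[abs_def] .
  qed
  have h_cm: "cm_upto n (h j)" for n j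
    by (induction n arbitrary: j) (auto intro: cm_upto_SucI h_nonneg h_deriv)
  have R_deriv: "(?R has_real_derivative - (h 0 s * ?R s)) (at s)" if "s \<ge> 0" for s
  proof -
    have "(?R has_real_derivative
        (?R s * (\<Sum>k<length as. 1 / (bs ! k + s) - 1 / (as ! k + s)))) (at s)"
      using pos that
      by (intro DERIV_fun_exp DERIV_sum DERIV_diff) (auto intro!: derivative_eq_intros)
    also have "(\<Sum>k<length as. 1 / (bs ! k + s) - 1 / (as ! k + s)) = - h 0 s"
      unfolding h_def sum_negf[symmetric] by (intro sum.cong) auto
    finally show ?thesis by (simp add: mult.commute)
  qed
  show ?thesis
  proof (induction n)
    case (Suc n)
    show ?case
      by (rule cm_upto_SucI[OF _ cm_upto_mult[OF h_cm[of n 0] Suc] R_deriv]) auto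
  qed auto
qed

lemma pochhammer_list_0: "pochhammer_list as 0 = 1"
  unfolding pochhammer_list_def by (induction as) simp_all

lemma pochhammer_list_Suc:
  "pochhammer_list as (Suc n) = pochhammer_list as n * (\<Prod>a\<leftarrow>as. a + of_nat n)"
  unfolding pochhammer_list_def by (induction as) (simp_all add: pochhammer_Suc algebra_simps)

text \<open>
  With \<open>R(s) = \<Prod> (b + s) / (a + s)\<close>, the sequence in question has successive ratios \<open>1 / R(n)\<close>. Since
  \<open>R(s) \<rightarrow> 1\<close> at infinity, telescoping turns it into the limit of the products
  \<open>\<Prod>\<^bsub>i<N\<^esub> R(n + i) / R(i)\<close>, a discrete substitute for Euler's product for the Gamma function. Each
  product is a completely monotone function of \<open>n\<close>.
\<close>
lemma completely_monotone_pochhammer_ratio: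
  assumes len: "length as = length bs" and a: "\<And>a. a \<in> set as \<Longrightarrow> a > 0"
    and v: "\<And>t. t \<in> {0..1} \<Longrightarrow> v_fun as bs t \<ge> 0"
  shows "completely_monotone (\<lambda>n. pochhammer_list as n / pochhammer_list bs n)"
proof -
  have b: "b > 0" if "b \<in> set bs" for b
    using v_fun_nonneg_imp_pos[OF assms that] .
  define R where "R s = exp (\<Sum>k<length as. ln (bs ! k + s) - ln (as ! k + s))" for s
  have R_pos: "R s > 0" for s
    by (simp add: R_def)
  have R_eq: "R (real n) = (\<Prod>b\<leftarrow>bs. b + real n) / (\<Prod>a\<leftarrow>as. a + real n)" for n
  proof -
    have "R (real n) = (\<Prod>k<length as. exp (ln (bs ! k + real n) - ln (as ! k + real n)))"
      by (simp add: R_def exp_sum)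
    also have "\<dots> = (\<Prod>k<length as. (bs ! k + real n) / (as ! k + real n))"
      using len a b by (intro prod.cong refl) (auto simp: exp_diff add_pos_nonneg)
    also have "\<dots> = (\<Prod>k<length bs. bs ! k + real n) / (\<Prod>k<length as. as ! k + real n)"
      by (simp add: prod_dividef len)
    also have "\<dots> = (\<Prod>b\<leftarrow>bs. b + real n) / (\<Prod>a\<leftarrow>as. a + real n)"
      by (simp add: prod.list_conv_set_nth lessThan_atLeast0)
    finally show ?thesis .
  qed
  \<comment> \<open>The lists have equal length, so the powers of \<open>N\<close> in numerator and denominator balance.\<close>
  have R_lim: "(\<lambda>N. R (real N)) \<longlonglongrightarrow> 1"
  proof -
    have "(\<lambda>N. \<Sum>k<length as. ln (bs ! k + real N) - ln (as ! k + real N))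
            \<longlonglongrightarrow> (\<Sum>k<length as. 0)"
      by (intro tendsto_sum) real_asymp
    then show ?thesis
      unfolding R_def using tendsto_exp by fastforce
  qed
  have m_Suc: "pochhammer_list as (Suc n) / pochhammer_list bs (Suc n) =
      pochhammer_list as n / pochhammer_list bs n / R (real n)" for n
    by (simp add: pochhammer_list_Suc R_eq)
  define u where "u N n = (\<Prod>i<N. R (real n + real i)) * (1 / (\<Prod>i<N. R (real i)))" for N n
  have "completely_monotone (u N)" for N
  proof -
    have "cm_upto j (\<lambda>s. (\<Prod>i<N. R (s + real i)) * (1 / (\<Prod>i<N. R (real i))))" for j
      unfolding R_def
      by (intro cm_upto_mult cm_upto_prod cm_upto_const cm_upto_shift[where c = "real _"]
            cm_upto_shift_ratio assms) (auto intro: prod_nonneg)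
    from completely_monotone_of_cm_upto[OF this] show ?thesis
      by (simp add: u_def[abs_def])
  qed
  moreover have "(\<lambda>N. u N n) \<longlonglongrightarrow> pochhammer_list as n / pochhammer_list bs n" for n
  proof (induction n)
    case 0
    have "u N 0 = 1" for N
      using R_pos by (simp add: u_def prod_pos less_imp_neq[symmetric])
    then show ?case
      by (simp add: pochhammer_list_0)
  next
    case (Suc n)
    \<comment> \<open>Raising \<open>n\<close> shifts the window of factors by one: the first is lost and \<open>R (N + n)\<close> is gained.\<close>
    have "u N (Suc n) = u N n * R (real (N + n)) / R (real n)" for N
    proof -
      have "R (real n) * (\<Prod>i<N. R (real (Suc n) + real i)) = (\<Prod>i<Suc N. R (real n + real i))"
        by (subst prod.lessThan_Suc_shift) (simp add: add_ac)
      also have "\<dots> = (\<Prod>i<N. R (real n + real i)) * R (real (N + n))"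
        by (simp add: add_ac)
      finally show ?thesis
        using R_pos[THEN less_imp_neq, symmetric] by (simp add: u_def field_simps)
    qed
    moreover have "(\<lambda>N. u N n * R (real (N + n)) / R (real n)) \<longlonglongrightarrow>
        pochhammer_list as n / pochhammer_list bs n * 1 / R (real n)"
      using R_pos[of "real n"]
      by (intro tendsto_divide tendsto_mult Suc.IH tendsto_const LIMSEQ_ignore_initial_segment[OF R_lim]) auto
    ultimately show ?case
      by (simp add: m_Suc)
  qed
  ultimately show ?thesis
    by (rule completely_monotone_limit)
qed

section \<open>Bernstein quadrature\<close>

text \<open>
  The integral of the \<open>k\<close>-th Bernstein polynomial of degree \<open>N\<close> against the measure that \<open>m\<close> would have
  as moments: a discrete approximation of this measure, with its mass at \<open>k / N\<close>.
\<close>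
definition bernstein_weight :: "(nat \<Rightarrow> real) \<Rightarrow> nat \<Rightarrow> nat \<Rightarrow> real" where
  "bernstein_weight m N k = real (N choose k) * (nabla ^^ (N - k)) m k"

lemma bernstein_weight_nonneg: "completely_monotone m \<Longrightarrow> bernstein_weight m N k \<ge> 0"
  by (simp add: bernstein_weight_def completely_monotone_def)

text \<open>
  The binomial theorem for the commuting operators \<open>nabla\<close> and shift, whose sum is the identity.
\<close>
lemma sum_binomial_nabla: "(\<Sum>l\<le>M. real (M choose l) * (nabla ^^ (M - l)) m (i + l)) = m i"
proof (induction M arbitrary: m i)
  case (Suc M)
  let ?t = "\<lambda>l. (nabla ^^ (Suc M - l)) m (i + l)"
  have "(\<Sum>l\<le>Suc M. real (Suc M choose l) * ?t l) =
      ?t 0 + (\<Sum>l\<le>M. real (Suc M choose Suc l) * ?t (Suc l))"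
    by (subst sum.atMost_Suc_shift) simp
  also have "\<dots> = ?t 0 + (\<Sum>l\<le>M. real (M choose Suc l) * ?t (Suc l)) +
      (\<Sum>l\<le>M. real (M choose l) * ?t (Suc l))"
    by (simp add: sum.distrib algebra_simps)
  also have "?t 0 + (\<Sum>l\<le>M. real (M choose Suc l) * ?t (Suc l)) =
      (\<Sum>l\<le>Suc M. real (M choose l) * ?t l)"
    by (subst sum.atMost_Suc_shift) simp
  also have "\<dots> = (\<Sum>l\<le>M. real (M choose l) * ?t l)"
    by simp
  also have "\<dots> = (\<Sum>l\<le>M. real (M choose l) * (nabla ^^ (M - l)) (nabla m) (i + l))"
    by (intro sum.cong refl) (simp add: Suc_diff_le funpow_Suc_right del: funpow.simps)
  also have "\<dots> = nabla m i"
    by (rule Suc.IH)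
  also have "(\<Sum>l\<le>M. real (M choose l) * ?t (Suc l)) = m (Suc i)"
    using Suc.IH[of m "Suc i"] by simp
  finally show ?case
    by (simp add: nabla_def)
qed simp

text \<open>
  Bernstein quadrature reproduces these binomial moments without error, because
  \<open>(N choose k) (k choose i) = (N choose i) (N - i choose k - i)\<close>. The powers \<open>(k / N)\<^sup>i\<close> differ from the
  quotients of binomial coefficients by a term that vanishes as \<open>N\<close> grows, uniformly in \<open>k\<close>.
\<close>
lemma bernstein_weight_factorial_moment:
  assumes "i \<le> N"
  shows "(\<Sum>k\<le>N. bernstein_weight m N k * (real (k choose i) / real (N choose i))) = m i"
proof -
  have "(\<Sum>k\<le>N. bernstein_weight m N k * (real (k choose i) / real (N choose i))) =
      (\<Sum>k\<in>{i..N}. bernstein_weight m N k * (real (k choose i) / real (N choose i)))"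
    by (rule sum.mono_neutral_right) auto
  also have "\<dots> = (\<Sum>l\<le>N - i. real (N - i choose l) * (nabla ^^ (N - i - l)) m (i + l))"
  proof (rule sum.reindex_bij_witness[of _ "\<lambda>l. i + l" "\<lambda>k. k - i"])
    fix k assume k: "k \<in> {i..N}"
    have "real (N choose k) * real (k choose i) = real (N choose i) * real (N - i choose (k - i))"
      using k choose_mult[of i k N] by (simp flip: of_nat_mult)
    moreover have "real (N choose i) > 0"
      using assms by simp
    ultimately have *: "real (N - i choose (k - i)) =
        real (N choose k) * (real (k choose i) / real (N choose i))"
      by (simp add: field_simps)
    show "real (N - i choose (k - i)) * (nabla ^^ (N - i - (k - i))) m (i + (k - i)) =
        bernstein_weight m N k * (real (k choose i) / real (N choose i))"
      using k unfolding * bernstein_weight_def by simp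
  qed (use assms in auto)
  also have "\<dots> = m i"
    by (rule sum_binomial_nabla)
  finally show ?thesis .
qed

lemma choose_ratio_close_to_power:
  assumes "k \<le> N" "2 * i < N"
  shows "\<bar>real (k choose i) / real (N choose i) - (real k / real N) ^ i\<bar> \<le> real i * (real i / (real N - real i))"
proof -
  have prod_eq: "real (n choose i) = (\<Prod>j<i. real n - real j) / fact i" for n
    by (simp add: binomial_gbinomial gbinomial_prod_rev lessThan_atLeast0)
  have "real (k choose i) / real (N choose i) = (\<Prod>j<i. (real k - real j) / (real N - real j))"
    by (simp add: prod_eq prod_dividef)
  moreover have "(real k / real N) ^ i = (\<Prod>j<i. real k / real N)"
    by simp
  moreover have "\<bar>(\<Prod>j<i. (real k - real j) / (real N - real j)) - (\<Prod>j<i. real k / real N)\<bar> \<le>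
      (\<Sum>j<i. \<bar>(real k - real j) / (real N - real j) - real k / real N\<bar>)"
    using assms
    by (intro norm_prod_diff[where 'a = real, unfolded real_norm_def]) (auto simp: field_simps abs_le_iff)
  moreover have "\<dots> \<le> (\<Sum>j<i. real i / (real N - real i))"
  proof (rule sum_mono)
    fix j assume j: "j \<in> {..<i}"
    have "(real k - real j) / (real N - real j) - real k / real N =
        - (real j / (real N - real j)) * ((real N - real k) / real N)"
      using assms j by (simp add: field_simps)
    then have "\<bar>(real k - real j) / (real N - real j) - real k / real N\<bar> =
        real j / (real N - real j) * ((real N - real k) / real N)"
      using assms j by (simp add: abs_mult)
    also have "\<dots> \<le> real j / (real N - real j) * 1"
      using assms j by (intro mult_left_mono) auto
    also have "\<dots> \<le> real i / (real N - real i)"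
      using assms j by (auto intro!: frac_le)
    finally show "\<bar>(real k - real j) / (real N - real j) - real k / real N\<bar> \<le> real i / (real N - real i)" .
  qed
  ultimately show ?thesis by simp
qed

lemma bernstein_weight_sum: "(\<Sum>k\<le>N. bernstein_weight m N k) = m 0"
  using bernstein_weight_factorial_moment[of 0 N m] by simp

lemma bernstein_power_moment_tendsto:
  assumes m: "completely_monotone m"
  shows "(\<lambda>N. \<Sum>k\<le>N. bernstein_weight m N k * (real k / real N) ^ i) \<longlonglongrightarrow> m i"
proof (rule Lim_transform2)
  show "(\<lambda>N. m i) \<longlonglongrightarrow> m i" by simp
  show "(\<lambda>N. m i - (\<Sum>k\<le>N. bernstein_weight m N k * (real k / real N) ^ i)) \<longlonglongrightarrow> 0"
  proof (rule Lim_null_comparison)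
    show "\<forall>\<^sub>F N in sequentially.
        norm (m i - (\<Sum>k\<le>N. bernstein_weight m N k * (real k / real N) ^ i))
          \<le> m 0 * (real i * (real i / (real N - real i)))"
      using eventually_gt_at_top[of "2 * i"]
    proof eventually_elim
      case (elim N)
      have "m i - (\<Sum>k\<le>N. bernstein_weight m N k * (real k / real N) ^ i) =
          (\<Sum>k\<le>N. bernstein_weight m N k * (real (k choose i) / real (N choose i) - (real k / real N) ^ i))"
        using elim bernstein_weight_factorial_moment[of i N m]
        by (simp only: right_diff_distrib sum_subtractf)
      also have "norm \<dots> \<le> (\<Sum>k\<le>N. bernstein_weight m N k * (real i * (real i / (real N - real i))))"
      proof (rule sum_norm_le)
        fix k assume "k \<in> {..N}"
        with elim have "norm (real (k choose i) / real (N choose i) - (real k / real N) ^ i) \<le>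
            real i * (real i / (real N - real i))"
          unfolding real_norm_def by (intro choose_ratio_close_to_power) auto
        then show "norm (bernstein_weight m N k * (real (k choose i) / real (N choose i) - (real k / real N) ^ i))
            \<le> bernstein_weight m N k * (real i * (real i / (real N - real i)))"
          unfolding norm_mult using bernstein_weight_nonneg[OF m, of N k]
          by (intro mult_mono) auto
      qed
      also have "\<dots> = m 0 * (real i * (real i / (real N - real i)))"
        by (simp only: bernstein_weight_sum flip: sum_distrib_right)
      finally show ?case .
    qed
    show "(\<lambda>N. m 0 * (real i * (real i / (real N - real i)))) \<longlonglongrightarrow> 0"
      by real_asymp
  qed
qed

text \<open>
  The limit on power series stands in for integration of \<open>\<Sum> c\<^sub>n t\<^sup>n\<close> against the representing measure.
  Tannery's theorem applies because all quadrature moments are bounded by \<open>m 0\<close>.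
\<close>
lemma bernstein_functional_tendsto:
  fixes c :: "nat \<Rightarrow> complex"
  assumes m: "completely_monotone m" and c: "summable (\<lambda>n. norm (c n))"
  shows "(\<lambda>N. \<Sum>k\<le>N. of_real (bernstein_weight m N k) *
            (\<Sum>n. c n * of_real (real k / real N) ^ n)) \<longlonglongrightarrow> (\<Sum>n. c n * of_real (m n))"
proof -
  let ?M = "\<lambda>N n. \<Sum>k\<le>N. bernstein_weight m N k * (real k / real N) ^ n"
  have M_bounds: "norm (?M N n) \<le> m 0" for N n
  proof -
    have "norm (?M N n) \<le> (\<Sum>k\<le>N. bernstein_weight m N k)"
      using bernstein_weight_nonneg[OF m]
      by (intro sum_norm_le) (auto simp: abs_mult divide_le_eq intro!: mult_left_le power_le_one)
    then show ?thesis by (simp add: bernstein_weight_sum)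
  qed
  have sm: "summable (\<lambda>n. c n * of_real (real k / real N) ^ n)" if "k \<le> N" for k N
    by (rule summable_comparison_test'[OF c, of 0])
       (use that in \<open>auto simp: norm_mult norm_power norm_divide divide_le_eq intro!: mult_left_le power_le_one\<close>)
  have swap: "(\<Sum>n. c n * of_real (?M N n)) =
      (\<Sum>k\<le>N. of_real (bernstein_weight m N k) * (\<Sum>n. c n * of_real (real k / real N) ^ n))" for N
  proof -
    have "(\<Sum>n. c n * of_real (?M N n)) =
       (\<Sum>n. \<Sum>k\<le>N. of_real (bernstein_weight m N k) * (c n * of_real (real k / real N) ^ n))"
      by (simp add: sum_distrib_left mult_ac)
    also have "\<dots> = (\<Sum>k\<le>N. \<Sum>n. of_real (bernstein_weight m N k) * (c n * of_real (real k / real N) ^ n))"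
      by (intro suminf_sum summable_mult sm) auto
    also have "\<dots> = (\<Sum>k\<le>N. of_real (bernstein_weight m N k) * (\<Sum>n. c n * of_real (real k / real N) ^ n))"
      by (intro sum.cong refl suminf_mult sm) auto
    finally show ?thesis .
  qed
  have "eventually (\<lambda>N. summable (\<lambda>n. norm (c n * of_real (?M N n)))) sequentially \<and>
        summable (\<lambda>n. norm (c n * of_real (m n))) \<and>
        (\<lambda>N. \<Sum>n. c n * of_real (?M N n)) \<longlonglongrightarrow> (\<Sum>n. c n * of_real (m n))"
  proof (rule tannerys_theorem)
    show "(\<lambda>N. c n * of_real (?M N n)) \<longlonglongrightarrow> c n * of_real (m n)" for n
      by (intro tendsto_mult tendsto_const tendsto_of_real bernstein_power_moment_tendsto m)
    show "\<forall>\<^sub>F (n, N) in sequentially \<times>\<^sub>F sequentially. norm (c n * of_real (?M N n)) \<le> norm (c n) * m 0"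
      using M_bounds by (intro always_eventually) (auto simp: norm_mult simp del: of_real_sum intro!: mult_left_mono)
    show "summable (\<lambda>n. norm (c n) * m 0)"
      by (intro summable_mult2 c)
  qed auto
  then show "(\<lambda>N. \<Sum>k\<le>N. of_real (bernstein_weight m N k) *
            (\<Sum>n. c n * of_real (real k / real N) ^ n)) \<longlonglongrightarrow> (\<Sum>n. c n * of_real (m n))"
    unfolding swap by simp
qed

lemma sum_nonneg_Reals: "(\<And>x. x \<in> A \<Longrightarrow> f x \<in> \<real>\<^sub>\<ge>\<^sub>0) \<Longrightarrow> sum f A \<in> (\<real>\<^sub>\<ge>\<^sub>0 :: complex set)"
  by (induction A rule: infinite_finite_induct) auto

text \<open>
  The transfer principle: multiplying the coefficients of a series by a completely monotone sequence
  averages it over the arguments shrunk by \<open>t \<in> [0,1]\<close>, so nonnegativity is inherited.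
\<close>
lemma completely_monotone_series_nonneg:
  fixes c :: "nat \<Rightarrow> complex"
  assumes m: "completely_monotone m" and c: "summable (\<lambda>n. norm (c n))"
    and pos: "\<And>t. t \<in> {0..1} \<Longrightarrow> (\<Sum>n. c n * of_real t ^ n) \<in> \<real>\<^sub>\<ge>\<^sub>0"
  shows "(\<Sum>n. c n * of_real (m n)) \<in> \<real>\<^sub>\<ge>\<^sub>0"
proof (rule Lim_in_closed_set[OF closed_nonneg_Reals_complex _ _ bernstein_functional_tendsto[OF m c]])
  show "\<forall>\<^sub>F N in sequentially. (\<Sum>k\<le>N. of_real (bernstein_weight m N k) *
            (\<Sum>n. c n * of_real (real k / real N) ^ n)) \<in> \<real>\<^sub>\<ge>\<^sub>0"
    using bernstein_weight_nonneg[OF m]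
    by (intro always_eventually allI sum_nonneg_Reals nonneg_Reals_mult_I pos)
       (auto simp: divide_le_eq)
qed auto

section \<open>Hypergeometric series with positive coefficients\<close>

lemma pochhammer_list_of_real:
  "pochhammer_list (map of_real as) n = of_real (pochhammer_list as n)"
  unfolding pochhammer_list_def by (induction as) (simp_all add: pochhammer_of_real)

text \<open>
  The quotient of consecutive coefficients is \<open>(n + 1)\<^sup>q\<^sup>+\<^sup>1\<^sup>-\<^sup>p\<close> up to a factor that tends to 1, where
  \<open>p\<close> and \<open>q\<close> are the numbers of upper and lower parameters.
\<close>
lemma conv_radius_hypergeo:
  fixes as bs :: "real list"
  assumes a: "\<And>n. pochhammer_list as n \<noteq> 0" and b: "\<And>n. pochhammer_list bs n \<noteq> 0"
  defines "c \<equiv> (\<lambda>n. pochhammer_list as n / (pochhammer_list bs n * fact n))"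
  shows "length as \<le> length bs \<Longrightarrow> conv_radius c = \<infinity>"
    and "length as = length bs + 1 \<Longrightarrow> conv_radius c = 1"
proof -
  define r where "r xs n = (\<Prod>x\<leftarrow>xs. (x + real n) / real (n + 1))" for xs n
  have r_lim: "r xs \<longlonglongrightarrow> 1" for xs
  proof (induction xs)
    case (Cons x xs)
    have "(\<lambda>n. (x + real n) / real (n + 1)) \<longlonglongrightarrow> 1"
      by real_asymp
    from tendsto_mult[OF this Cons] show ?case by (simp add: r_def)
  qed (simp add: r_def)
  have r_eq: "(\<Prod>x\<leftarrow>xs. x + real n) = real (n + 1) ^ length xs * r xs n" for xs n
    unfolding r_def by (induction xs) (simp_all add: field_simps)
  have c_nz: "c n \<noteq> 0" for n
    using a b by (simp add: c_def)
  have ratio: "norm (c n) / norm (c (Suc n)) =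
     real (n + 1) ^ Suc (length bs) / real (n + 1) ^ length as * (\<bar>r bs n\<bar> / \<bar>r as n\<bar>)" for n
  proof -
    have "c (Suc n) = c n * ((\<Prod>a\<leftarrow>as. a + real n) / ((\<Prod>b\<leftarrow>bs. b + real n) * real (n + 1)))"
      by (simp add: c_def pochhammer_list_Suc)
    then have "c n / c (Suc n) = (\<Prod>b\<leftarrow>bs. b + real n) * real (n + 1) / (\<Prod>a\<leftarrow>as. a + real n)"
      using c_nz[of n] by simp
    also have "\<dots> = real (n + 1) ^ Suc (length bs) / real (n + 1) ^ length as * (r bs n / r as n)"
      by (simp only: r_eq) simp
    finally have "norm (c n / c (Suc n)) = norm \<dots>"
      by (rule arg_cong)
    then show ?thesis
      by (simp only: real_norm_def abs_divide abs_mult power_abs abs_of_nat)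
  qed
  have r_ratio: "(\<lambda>n. \<bar>r bs n\<bar> / \<bar>r as n\<bar>) \<longlonglongrightarrow> 1"
    using tendsto_divide[OF tendsto_rabs[OF r_lim[of bs]] tendsto_rabs[OF r_lim[of as]]] by simp
  {
    assume le: "length as \<le> length bs"
    have "filterlim (\<lambda>n. real (n + 1)) at_top sequentially"
      by real_asymp
    then have "filterlim (\<lambda>n. \<bar>r bs n\<bar> / \<bar>r as n\<bar> * real (n + 1) ^ (Suc (length bs) - length as)) at_top sequentially"
      using le by (intro filterlim_tendsto_pos_mult_at_top[OF r_ratio] filterlim_pow_at_top) auto
    then have "filterlim (\<lambda>n. norm (c n) / norm (c (Suc n))) at_top sequentially"
      using le by (simp only: ratio) (simp add: power_diff mult.commute)
    then have "(\<lambda>n. ereal (norm (c n) / norm (c (Suc n)))) \<longlonglongrightarrow> \<infinity>"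
      by (simp only: tendsto_PInfty_eq_at_top)
    then show "conv_radius c = \<infinity>"
      using c_nz by (intro conv_radius_ratio_limit_ereal) auto
  next
    assume "length as = length bs + 1"
    then have "norm (c n) / norm (c (Suc n)) = \<bar>r bs n\<bar> / \<bar>r as n\<bar>" for n
      by (simp only: ratio) simp
    with r_ratio show "conv_radius c = 1"
      using c_nz by (intro conv_radius_ratio_limit[of _ 1]) (auto simp: one_ereal_def)
  }
qed

lemma eval_fps_hypergeo_of_real:
  "eval_fps (fps_hypergeo (map of_real as) (map of_real bs) 1) (z :: complex) =
     (\<Sum>n. z ^ n / fact n * of_real (pochhammer_list as n / pochhammer_list bs n))"
  unfolding eval_fps_hypergeo pochhammer_list_of_real by (simp add: mult_ac)

lemma hypergeo_series_nonneg_of_coeffs: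
  assumes pos: "\<And>n. pochhammer_list as n / pochhammer_list bs n > 0" and y: "y \<ge> 0"
    and conv: "length as \<le> length bs \<or> length as = length bs + 1 \<and> y < 1"
  shows "eval_fps (fps_hypergeo (map of_real as) (map of_real bs) 1) (of_real y :: complex) \<in> \<real>\<^sub>\<ge>\<^sub>0"
proof -
  let ?c = "\<lambda>n. pochhammer_list as n / (pochhammer_list bs n * fact n)"
  have nz: "pochhammer_list as n \<noteq> 0" "pochhammer_list bs n \<noteq> 0" for n
    using pos[of n] by auto
  have "ereal (norm y) < conv_radius ?c"
    using conv conv_radius_hypergeo[OF nz] y by auto
  then have "summable (\<lambda>n. ?c n * y ^ n)"
    by (rule summable_in_conv_radius)
  moreover have "?c n * y ^ n \<ge> 0" for n
    using mult_nonneg_nonneg[OF divide_nonneg_nonneg[OF less_imp_le[OF pos] fact_ge_zero] zero_le_power[OF y], of n n n]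
    by simp
  ultimately have "(\<Sum>n. ?c n * y ^ n) \<ge> 0" "(\<lambda>n. of_real (?c n * y ^ n) :: complex) sums of_real (\<Sum>n. ?c n * y ^ n)"
    by (auto intro: suminf_nonneg simp only: sums_of_real_iff summable_sums)
  then have "(\<Sum>n. of_real (?c n * y ^ n) :: complex) \<in> \<real>\<^sub>\<ge>\<^sub>0"
    by (simp add: sums_unique[symmetric])
  also have "(\<Sum>n. of_real (?c n * y ^ n) :: complex) = eval_fps (fps_hypergeo (map of_real as) (map of_real bs) 1) (of_real y)"
    unfolding eval_fps_hypergeo pochhammer_list_of_real by simp
  finally show ?thesis .
qed

section \<open>As many upper as lower parameters\<close>

text \<open>
  Here the series to be averaged is that of the exponential function.
\<close>
lemma hypergeo_confluent_nonneg:
  assumes "length as = length bs" "\<And>a. a \<in> set as \<Longrightarrow> a > 0"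
    and "\<And>t. t \<in> {0..1} \<Longrightarrow> v_fun as bs t \<ge> 0"
  shows "eval_fps (fps_hypergeo (map of_real as) (map of_real bs) 1) (of_real y :: complex) \<in> \<real>\<^sub>\<ge>\<^sub>0"
  unfolding eval_fps_hypergeo_of_real
proof (rule completely_monotone_series_nonneg[OF completely_monotone_pochhammer_ratio[OF assms]])
  show "summable (\<lambda>n. norm (complex_of_real y ^ n / fact n))"
    using summable_norm_exp[of "complex_of_real y"] by (simp add: scaleR_conv_of_real field_simps)
  fix t :: real
  have "(\<Sum>n. complex_of_real y ^ n / fact n * of_real t ^ n) = exp (of_real (y * t))"
    unfolding exp_def by (simp add: scaleR_conv_of_real field_simps)
  also have "\<dots> = of_real (exp (y * t))"
    by (rule exp_of_real)
  finally show "(\<Sum>n. complex_of_real y ^ n / fact n * of_real t ^ n) \<in> \<real>\<^sub>\<ge>\<^sub>0"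
    by simp
qed

section \<open>One upper parameter fewer\<close>

lemma pochhammer_three_halves_fact:
  "2 * (4 ^ n * (pochhammer (3/2) n * pochhammer 2 n)) = (fact (2 * n + 2) :: real)"
proof (induction n)
  case (Suc n)
  have "2 * (4 ^ Suc n * (pochhammer (3/2) (Suc n) * pochhammer 2 (Suc n))) =
     4 * (3/2 + real n) * (2 + real n) * (2 * (4 ^ n * (pochhammer (3/2) n * pochhammer 2 n)) :: real)"
    by (simp add: pochhammer_Suc mult_ac)
  also have "\<dots> = fact (2 * Suc n + 2)"
    unfolding Suc.IH by (simp add: algebra_simps)
  finally show ?case .
qed (simp add: numeral_2_eq_2)

text \<open>
  Up to the scaling of the argument this is \<open>(sin x / x)\<^sup>2\<close>: it is \<open>\<^sub>1F\<^sub>2(1; 3/2, 2; - x\<^sup>2 / 4)\<close>, whose sum is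
  \<open>2 (1 - cos x) / x\<^sup>2\<close> by the cosine series.
\<close>
lemma squared_sinc_series:
  assumes "x \<noteq> (0::real)"
  shows "(\<lambda>n. (- (x\<^sup>2) / 4) ^ n / (pochhammer (3/2) n * pochhammer 2 n)) sums (2 * (1 - cos x) / x\<^sup>2)"
proof -
  have "(\<lambda>n. (- 1) ^ Suc n / fact (2 * Suc n) * x ^ (2 * Suc n)) sums (cos x - 1)"
    using cos_paired[of x] by (subst sums_Suc_iff) simp
  from sums_mult[OF this, of "- 2 / x\<^sup>2"]
  have "(\<lambda>n. - 2 / x\<^sup>2 * ((- 1) ^ Suc n / fact (2 * Suc n) * x ^ (2 * Suc n))) sums
          (- 2 / x\<^sup>2 * (cos x - 1))" .
  also have "- 2 / x\<^sup>2 * (cos x - 1) = 2 * (1 - cos x) / x\<^sup>2"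
    using assms by (simp add: divide_simps)
  also have "(\<lambda>n. - 2 / x\<^sup>2 * ((- 1) ^ Suc n / fact (2 * Suc n) * x ^ (2 * Suc n))) =
       (\<lambda>n. (- (x\<^sup>2) / 4) ^ n / (pochhammer (3/2) n * pochhammer 2 n))"
  proof
    fix n
    have "- 2 / x\<^sup>2 * ((- 1) ^ Suc n / fact (2 * Suc n) * x ^ (2 * Suc n)) =
        2 * (- (x\<^sup>2)) ^ n / fact (2 * n + 2)"
      using assms by (simp add: power_minus[of "x * x"] power_mult power2_eq_square[of x] del: fact_Suc)
    also have "\<dots> = (- (x\<^sup>2) / 4) ^ n / (pochhammer (3/2) n * pochhammer 2 n)"
      unfolding power_divide by (simp only: flip: pochhammer_three_halves_fact) simp
    finally show "- 2 / x\<^sup>2 * ((- 1) ^ Suc n / fact (2 * Suc n) * x ^ (2 * Suc n)) =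
        (- (x\<^sup>2) / 4) ^ n / (pochhammer (3/2) n * pochhammer 2 n)" .
  qed
  finally show ?thesis .
qed

text \<open>
  The sum is a square for \<open>y < 0\<close>, a series with positive terms otherwise.
\<close>
lemma squared_sinc_kernel:
  fixes y :: real
  shows "summable (\<lambda>n. \<bar>y ^ n / (pochhammer (3/2) n * pochhammer 2 n)\<bar>)"
    and "(\<Sum>n. y ^ n / (pochhammer (3/2) n * pochhammer 2 n)) \<ge> 0"
proof -
  let ?g = "\<lambda>n. pochhammer (3/2) n * pochhammer 2 n :: real"
  have g: "?g n > 0" for n
    by (intro mult_pos_pos pochhammer_pos) auto
  show sm: "summable (\<lambda>n. \<bar>y ^ n / ?g n\<bar>)" for y
  proof (rule summable_comparison_test'[OF summable_norm_exp[of y], of 0])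
    fix n
    have "pochhammer 1 n \<le> (pochhammer (3/2) n :: real)" and "1 \<le> (pochhammer 2 n :: real)"
      by (induction n) (auto simp: pochhammer_Suc intro!: mult_mono mult_ge1_I pochhammer_nonneg)
    then have "fact n * 1 \<le> ?g n"
      by (intro mult_mono) (auto simp: pochhammer_fact pochhammer_nonneg)
    then have "\<bar>y\<bar> ^ n / ?g n \<le> \<bar>y\<bar> ^ n / fact n"
      using g[of n] by (intro divide_left_mono) auto
    moreover have "norm \<bar>y ^ n / ?g n\<bar> = \<bar>y\<bar> ^ n / ?g n"
      by (simp only: real_norm_def abs_idempotent abs_divide power_abs abs_of_pos[OF g])
    moreover have "norm (y ^ n /\<^sub>R fact n) = \<bar>y\<bar> ^ n / fact n"
      by (simp add: abs_mult power_abs divide_inverse mult.commute)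
    ultimately show "norm \<bar>y ^ n / ?g n\<bar> \<le> norm (y ^ n /\<^sub>R fact n)"
      by (simp only:)
  qed
  show "(\<Sum>n. y ^ n / ?g n) \<ge> 0"
  proof (cases "y \<ge> 0")
    case True
    then show ?thesis
      by (intro suminf_nonneg summable_rabs_cancel[OF sm[of y]] divide_nonneg_pos zero_le_power g)
  next
    case False
    \<comment> \<open>The squared sinc series has argument \<open>- x\<^sup>2 / 4\<close>.\<close>
    define x where "x = 2 * sqrt (- y)"
    have x: "x \<noteq> 0" "y = - (x\<^sup>2) / 4"
      using False by (simp_all add: x_def power_mult_distrib)
    have "(\<Sum>n. y ^ n / ?g n) = 2 * (1 - cos x) / x\<^sup>2"
      using squared_sinc_series[OF x(1)] unfolding x(2) by (simp add: sums_iff)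
    then show ?thesis by simp
  qed
qed

lemma v_fun_eq_sum_list:
  "length as = length bs \<Longrightarrow> v_fun as bs t = (\<Sum>a\<leftarrow>as. t powr a) - (\<Sum>b\<leftarrow>bs. t powr b)"
  by (simp add: v_fun_def sum_subtractf sum_list_sum_nth lessThan_atLeast0)

lemma sum_list_remove_nth:
  fixes f :: "'a \<Rightarrow> 'b :: ab_group_add"
  assumes "k < length xs"
  shows "(\<Sum>x\<leftarrow>remove_nth k xs. f x) = (\<Sum>x\<leftarrow>xs. f x) - f (xs ! k)"
proof -
  have "(\<Sum>x\<leftarrow>xs. f x) = (\<Sum>x\<leftarrow>take k xs @ xs ! k # drop (Suc k) xs. f x)"
    using id_take_nth_drop[OF assms] by simp
  then show ?thesis
    by (simp add: remove_nth_def)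
qed

lemma length_remove_nth: "k < length xs \<Longrightarrow> length (remove_nth k xs) = length xs - 1"
  by (simp add: remove_nth_def)

text \<open>
  Adjoining 2 to the upper and 1 to the lower parameters pairs off with the two exponents that were removed.
  Their contribution is \<open>t\<^sup>a + t\<^sup>2 - t\<^sup>b - t\<close>, and \<open>b \<ge> a + 1\<close> bounds it below by \<open>(1 - t) (t\<^sup>a - t)\<close>, which
  is nonnegative as \<open>a \<le> 1\<close>.
\<close>
lemma extended_v_fun_nonneg:
  assumes len: "length bs = length as" and k: "k < length as" and s: "s < length bs"
    and le: "as ! k \<le> min 1 (bs ! s - 1)"
    and v: "v_fun (remove_nth k as) (remove_nth s bs) t \<ge> 0" and t: "t \<in> {0..1}"
  shows "v_fun (as @ [2]) (bs @ [1]) t \<ge> 0"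
proof -
  have "v_fun (as @ [2]) (bs @ [1]) t = v_fun (remove_nth k as) (remove_nth s bs) t +
      (t powr (as ! k) + t powr 2 - t powr (bs ! s) - t powr 1)"
    using len k s by (simp add: v_fun_eq_sum_list length_remove_nth sum_list_remove_nth)
  moreover have "t powr (as ! k) + t powr 2 - t powr (bs ! s) - t powr 1 \<ge> 0"
  proof (cases "t = 0")
    case False
    with t have t: "0 < t" "t \<le> 1" by auto
    have "t powr (bs ! s) \<le> t powr (as ! k + 1)"
      using le t by (intro powr_mono') auto
    also have "\<dots> = t * t powr (as ! k)"
      using t by (simp add: powr_add)
    finally have "t powr (as ! k) + t powr 2 - t powr (bs ! s) - t powr 1 \<ge> (1 - t) * (t powr (as ! k) - t)"
      using t by (simp add: algebra_simps power2_eq_square)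
    moreover have "t powr 1 \<le> t powr (as ! k)"
      using le t by (intro powr_mono') auto
    then have "(1 - t) * (t powr (as ! k) - t) \<ge> 0"
      using t by (intro mult_nonneg_nonneg) auto
    ultimately show ?thesis
      by linarith
  qed auto
  ultimately show ?thesis
    using v by linarith
qed

text \<open>
  Cancelling \<open>(3/2)\<^sub>n (2)\<^sub>n\<close> and \<open>(1)\<^sub>n = n!\<close>, the series becomes the one of the squared sinc function, with
  coefficients multiplied by the ratio for the enlarged parameter lists.
\<close>
lemma hypergeo_squared_sinc_nonneg:
  assumes len: "length bs = length as + 1" and a: "\<And>a. a \<in> set as \<Longrightarrow> a > 0"
    and v: "\<And>t. t \<in> {0..1} \<Longrightarrow> v_fun (as @ [3/2, 2]) (bs @ [1]) t \<ge> 0"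
  shows "eval_fps (fps_hypergeo (map of_real as) (map of_real bs) 1) (of_real y :: complex) \<in> \<real>\<^sub>\<ge>\<^sub>0"
proof -
  let ?g = "\<lambda>n. pochhammer (3/2) n * pochhammer 2 n :: real"
  let ?m = "\<lambda>n. pochhammer_list (as @ [3/2, 2]) n / pochhammer_list (bs @ [1]) n"
  have m: "completely_monotone ?m"
    by (rule completely_monotone_pochhammer_ratio) (use len a v in auto)
  have "(\<Sum>n. of_real (y ^ n / ?g n) * of_real (?m n) :: complex) \<in> \<real>\<^sub>\<ge>\<^sub>0"
  proof (rule completely_monotone_series_nonneg[OF m])
    show "summable (\<lambda>n. norm (of_real (y ^ n / ?g n) :: complex))"
      using squared_sinc_kernel(1)[of y] by (simp only: norm_of_real)
    fix t :: real
    have "summable (\<lambda>n. (y * t) ^ n / ?g n)"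
      using squared_sinc_kernel(1) by (rule summable_rabs_cancel)
    then have "(\<lambda>n. of_real ((y * t) ^ n / ?g n) :: complex) sums of_real (\<Sum>n. (y * t) ^ n / ?g n)"
      by (simp only: sums_of_real_iff summable_sums)
    then have "(\<Sum>n. of_real (y ^ n / ?g n) * of_real t ^ n :: complex) = of_real (\<Sum>n. (y * t) ^ n / ?g n)"
      by (simp add: sums_iff power_mult_distrib)
    then show "(\<Sum>n. of_real (y ^ n / ?g n) * of_real t ^ n :: complex) \<in> \<real>\<^sub>\<ge>\<^sub>0"
      using squared_sinc_kernel(2)[of "y * t"] by simp
  qed
  moreover have "of_real (y ^ n / ?g n) * of_real (?m n) =
      (of_real y ^ n / fact n * of_real (pochhammer_list as n / pochhammer_list bs n) :: complex)" for n
  proof -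
    have "?g n \<noteq> 0"
      using pochhammer_pos[of "3/2 :: real" n] pochhammer_pos[of "2 :: real" n] by simp
    then have "y ^ n / ?g n * ?m n = y ^ n / fact n * (pochhammer_list as n / pochhammer_list bs n)"
      by (simp add: pochhammer_list_def pochhammer_fact)
    then have "complex_of_real (y ^ n / ?g n * ?m n) =
        of_real (y ^ n / fact n * (pochhammer_list as n / pochhammer_list bs n))"
      by (rule arg_cong)
    then show ?thesis
      by (simp only: of_real_mult of_real_divide of_real_power of_real_fact)
  qed
  ultimately show ?thesis
    by (simp only: eval_fps_hypergeo_of_real)
qed

section \<open>One upper parameter more\<close>

lemma pochhammer_binomial_series:
  assumes "norm (y :: complex) < 1"
  shows "(\<lambda>n. pochhammer a n / fact n * y ^ n) sums ((1 - y) powr (- a))"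
proof -
  have "(\<lambda>n. ((- a) gchoose n) * (- y) ^ n) sums (1 + (- y)) powr (- a)"
    by (rule gen_binomial_complex) (use assms in simp)
  moreover have "((- a) gchoose n) * (- y) ^ n = pochhammer a n / fact n * y ^ n" for n
    by (simp add: gbinomial_pochhammer power_minus[of y] mult_ac)
  ultimately show ?thesis by simp
qed

lemma summable_norm_pochhammer_binomial_series:
  assumes "norm (y :: complex) < 1"
  shows "summable (\<lambda>n. norm (pochhammer a n / fact n * y ^ n))"
proof (rule abs_summable_in_conv_radius)
  have "conv_radius (\<lambda>n. pochhammer a n / fact n) \<ge> 1"
  proof (rule conv_radius_geI_ex')
    fix r :: real assume "0 < r" "ereal r < 1"
    then show "summable (\<lambda>n. pochhammer a n / fact n * of_real r ^ n)"
      by (intro sums_summable[OF pochhammer_binomial_series]) auto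
  qed
  with assms show "ereal (norm y) < conv_radius (\<lambda>n. pochhammer a n / fact n)"
    by (auto intro: less_le_trans[where y = 1] simp: one_ereal_def)
qed

text \<open>
  The slit plane is starlike about 0, so the principal branch of \<open>(1 - z t)\<^sup>-\<^sup>\<alpha>\<close> is holomorphic on it for each
  \<open>t \<in> [0,1]\<close>.
\<close>
lemma one_minus_scaled_slit_notin:
  assumes "z \<in> slit_plane" "t \<in> {0..1}"
  shows "1 - z * of_real t \<notin> \<real>\<^sub>\<le>\<^sub>0"
proof
  assume "1 - z * of_real t \<in> \<real>\<^sub>\<le>\<^sub>0"
  then obtain r where r: "r \<le> 0" "1 - z * of_real t = of_real r"
    by (auto elim: nonpos_Reals_cases)
  have eq: "z * of_real t = of_real (1 - r)"
    using r(2) by (simp add: algebra_simps)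
  then have "t \<noteq> 0"
    using r(1) by (auto simp flip: of_real_diff)
  with assms(2) have "t > 0" by auto
  then have "z = of_real ((1 - r) / t)"
    using eq by (simp add: field_simps)
  moreover have "(1 - r) / t \<ge> 1"
    using r(1) assms(2) \<open>t > 0\<close> by (simp add: field_simps)
  ultimately show False
    using assms(1) unfolding slit_plane_def by blast
qed

text \<open>
  The candidate for the continuation is the integral of \<open>(1 - z t)\<^sup>-\<^sup>\<alpha>\<close> over \<open>t\<close>. Its Bernstein quadratures are
  holomorphic on the slit plane and bounded on compact subsets, uniformly in the degree, so Montel's
  theorem gives a holomorphic limit along a subsequence. On the unit disk the limit is forced to be the
  series, and on real \<open>y < 1\<close> the quadratures are sums of nonnegative numbers.
\<close>
lemma binomial_kernel_continuation:
  assumes m: "completely_monotone m"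
  obtains f where "f holomorphic_on slit_plane"
    "\<And>z. z \<in> ball 0 1 \<Longrightarrow> f z = (\<Sum>n. pochhammer (of_real \<alpha>) n / fact n * z ^ n * of_real (m n))"
    "\<And>y. y < 1 \<Longrightarrow> f (of_real y) \<in> \<real>\<^sub>\<ge>\<^sub>0"
proof -
  define K :: "complex \<Rightarrow> real \<Rightarrow> complex"
    where "K z t = (1 - z * of_real t) powr (- of_real \<alpha>)" for z t
  define F where "F N z = (\<Sum>k\<le>N. of_real (bernstein_weight m N k) * K z (real k / real N))" for N z
  have node: "real k / real N \<in> {0..1}" if "k \<le> N" for k N
    using that by (auto simp: divide_le_eq)
  have hol: "F N holomorphic_on slit_plane" for N
    unfolding F_def K_def
    by (intro holomorphic_intros one_minus_scaled_slit_notin node) auto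
  have bounded: "\<exists>B. \<forall>h\<in>range F. \<forall>z\<in>S. norm (h z) \<le> B" if S: "compact S" "S \<subseteq> slit_plane" for S
  proof -
    have notin: "1 - fst p * of_real (snd p) \<notin> \<real>\<^sub>\<le>\<^sub>0" if "p \<in> S \<times> {0..1}" for p :: "complex \<times> real"
      using that S by (intro one_minus_scaled_slit_notin) auto
    have "continuous_on (S \<times> {0..1})
        (\<lambda>p. exp (- of_real \<alpha> * Ln (1 - fst p * of_real (snd p))))"
      using notin by (intro continuous_intros) auto
    moreover have "K (fst p) (snd p) = exp (- of_real \<alpha> * Ln (1 - fst p * of_real (snd p)))"
      if "p \<in> S \<times> {0..1}" for p
    proof -
      have "1 - fst p * of_real (snd p) \<noteq> 0"
        using notin[OF that] by auto
      then show ?thesis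
        by (simp add: K_def powr_def)
    qed
    ultimately have "continuous_on (S \<times> {0..1}) (\<lambda>(z, t). K z t)"
      by (simp add: case_prod_unfold cong: continuous_on_cong)
    then have "bounded ((\<lambda>(z, t). K z t) ` (S \<times> {0..1}))"
      by (intro compact_imp_bounded compact_continuous_image compact_Times S) auto
    then obtain B where B: "\<And>z t. z \<in> S \<Longrightarrow> t \<in> {0..1} \<Longrightarrow> norm (K z t) \<le> B"
      unfolding bounded_iff by fastforce
    have "norm (F N z) \<le> m 0 * B" if "z \<in> S" for N z
    proof -
      have "norm (F N z) \<le> (\<Sum>k\<le>N. bernstein_weight m N k * B)"
        unfolding F_def
      proof (rule sum_norm_le)
        fix k assume "k \<in> {..N}"
        then have "norm (K z (real k / real N)) \<le> B"
          by (intro B that node) auto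
        then show "norm (of_real (bernstein_weight m N k) * K z (real k / real N)) \<le> bernstein_weight m N k * B"
          unfolding norm_mult norm_of_real abs_of_nonneg[OF bernstein_weight_nonneg[OF m]]
          by (rule mult_left_mono) (rule bernstein_weight_nonneg[OF m])
      qed
      also have "\<dots> = m 0 * B"
        by (simp only: bernstein_weight_sum flip: sum_distrib_right)
      finally show ?thesis .
    qed
    then show ?thesis by (intro exI[of _ "m 0 * B"]) auto
  qed
  \<comment> \<open>Only a subsequence is known to converge on the whole slit plane; the limit on the disk identifies it.\<close>
  obtain f r where f: "f holomorphic_on slit_plane" and r: "strict_mono (r :: nat \<Rightarrow> nat)"
    and lim: "\<And>z. z \<in> slit_plane \<Longrightarrow> (\<lambda>n. F (r n) z) \<longlonglongrightarrow> f z"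
    by (rule Montel[OF open_slit_plane, of "range F" F]) (use hol bounded in auto)
  show ?thesis
  proof (rule that[OF f])
    fix z :: complex assume z: "z \<in> ball 0 1"
    let ?c = "\<lambda>n. pochhammer (of_real \<alpha>) n / fact n * z ^ n"
    have "K z t = (\<Sum>n. ?c n * of_real t ^ n)" if "t \<in> {0..1}" for t
    proof -
      have "norm z * \<bar>t\<bar> \<le> norm z * 1"
        using that by (intro mult_left_mono) auto
      with z have "norm (z * of_real t) < 1"
        by (simp add: norm_mult)
      from pochhammer_binomial_series[OF this, of "of_real \<alpha>"] show ?thesis
        by (simp add: K_def sums_iff power_mult_distrib mult_ac)
    qed
    then have F_eq: "F N z = (\<Sum>k\<le>N. of_real (bernstein_weight m N k) * (\<Sum>n. ?c n * of_real (real k / real N) ^ n))" for N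
      unfolding F_def by (intro sum.cong refl arg_cong2[where f = "(*)"]) (use node in auto)
    have sm: "summable (\<lambda>n. norm (?c n))"
      using z by (intro summable_norm_pochhammer_binomial_series) simp
    have "(\<lambda>N. F N z) \<longlonglongrightarrow> (\<Sum>n. ?c n * of_real (m n))"
      unfolding F_eq by (rule bernstein_functional_tendsto[OF m sm])
    from LIMSEQ_subseq_LIMSEQ[OF this r] have "(\<lambda>n. F (r n) z) \<longlonglongrightarrow> (\<Sum>n. ?c n * of_real (m n))"
      by (simp add: o_def)
    with lim[of z] z ball_subset_slit_plane show "f z = (\<Sum>n. ?c n * of_real (m n))"
      by (blast intro: LIMSEQ_unique)
  next
    fix y :: real assume y: "y < 1"
    have K: "K (of_real y) t \<in> \<real>\<^sub>\<ge>\<^sub>0" if "t \<in> {0..1}" for t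
    proof -
      have "y * t \<le> 1"
        using that y mult_left_le[of t y] mult_nonpos_nonneg[of y t] by (cases "y \<ge> 0") auto
      then have "K (of_real y) t = of_real ((1 - y * t) powr (- \<alpha>))"
        unfolding K_def by (simp flip: powr_of_real)
      then show ?thesis by simp
    qed
    have "of_real y \<in> slit_plane"
      using y by (auto simp: slit_plane_def)
    moreover have "F N (of_real y) \<in> \<real>\<^sub>\<ge>\<^sub>0" for N
      unfolding F_def
      by (intro sum_nonneg_Reals nonneg_Reals_mult_I K node)
         (use bernstein_weight_nonneg[OF m] in auto)
    ultimately show "f (of_real y) \<in> \<real>\<^sub>\<ge>\<^sub>0"
      by (intro Lim_in_closed_set[OF closed_nonneg_Reals_complex _ _ lim]) auto
  qed
qed

lemma hypergeo_slit_nonneg: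
  assumes len: "length as = length bs" and a: "\<And>a. a \<in> set as \<Longrightarrow> a > 0"
    and v: "\<And>t. t \<in> {0..1} \<Longrightarrow> v_fun as bs t \<ge> 0"
    and as': "mset as' = add_mset \<alpha> (mset as)" and y: "y < 1"
  shows "hypergeo (map of_real as') (map of_real bs) (of_real y) \<in> \<real>\<^sub>\<ge>\<^sub>0"
proof -
  obtain f where f: "f holomorphic_on slit_plane"
    "\<And>z. z \<in> ball 0 1 \<Longrightarrow> f z = (\<Sum>n. pochhammer (of_real \<alpha>) n / fact n * z ^ n *
        of_real (pochhammer_list as n / pochhammer_list bs n))"
    "\<And>y. y < 1 \<Longrightarrow> f (of_real y) \<in> \<real>\<^sub>\<ge>\<^sub>0"
    using binomial_kernel_continuation[OF completely_monotone_pochhammer_ratio[OF len a v]] by blast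
  have "pochhammer_list as' n = pochhammer \<alpha> n * pochhammer_list as n" for n
    unfolding pochhammer_list_def using arg_cong[OF as', of "\<lambda>M. prod_mset (image_mset (\<lambda>a. pochhammer a n) M)"]
    by (simp flip: mset_map prod_mset_prod_list)
  then have "hypergeo_continuation (map of_real as') (map of_real bs) f"
    using f unfolding hypergeo_continuation_def eval_fps_hypergeo_of_real
    by (simp add: pochhammer_of_real mult_ac)
  moreover have "length as' = length bs + 1"
    using as' len by (metis Suc_eq_plus1 size_add_mset size_mset)
  moreover have "of_real y \<in> slit_plane"
    using y by (auto simp: slit_plane_def)
  ultimately show ?thesis
    using f(3)[OF y] hypergeo_eq_continuation[of "map of_real as'" "map of_real bs" f] by simp
qed

theorem theorem2:
  fixes p1 q1 :: nat and a1 b1 :: "real list" and x :: real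
  assumes "p1 \<le> q1 + 1"
    and "length a1 = p1" and "length b1 = q1"
    and "\<forall>b\<in>set b1. b \<notin> \<int>\<^sub>\<le>\<^sub>0"
    and cond:
      "((x \<ge> 0 \<and> p1 < q1 + 1 \<or> 0 \<le> x \<and> x < 1 \<and> 1 \<le> p1 \<and> p1 = q1 + 1) \<and>
          (\<forall>n. pochhammer_list a1 n / pochhammer_list b1 n > 0))
       \<or> (x < 1 \<and> 1 \<le> p1 \<and> p1 = q1 + 1 \<and>
          (let a1' = remove1 (Max (set a1)) a1
           in (\<forall>a\<in>set a1'. a > 0) \<and> (\<forall>t\<in>{0..1}. v_fun a1' b1 t \<ge> 0)))
       \<or> (p1 = q1 \<and> (\<forall>a\<in>set a1. a > 0) \<and> (\<forall>t\<in>{0..1}. v_fun a1 b1 t \<ge> 0))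
       \<or> (1 \<le> p1 \<and> q1 = p1 + 1 \<and> (\<forall>a\<in>set a1. a > 0) \<and>
          (let ah = a1 @ [3/2]; bh = b1
           in \<exists>k<q1. \<exists>s<q1. ah ! k \<le> min 1 (bh ! s - 1) \<and>
                (\<forall>t\<in>{0..1}. v_fun (remove_nth k ah) (remove_nth s bh) t \<ge> 0)))"
  shows "(p1 \<le> q1 \<longrightarrow>
            (\<forall>t>0. hypergeo (map of_real a1) (map of_real b1) (of_real (x * t)) \<in> \<real>\<^sub>\<ge>\<^sub>0)) \<and>
         (p1 = q1 + 1 \<longrightarrow>
            (\<forall>t. 0 < t \<and> t < 1 \<longrightarrow>
               hypergeo (map of_real a1) (map of_real b1) (of_real (x * t)) \<in> \<real>\<^sub>\<ge>\<^sub>0))"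
proof -
  note len = assms(2,3)
  have xt: "x * t < 1" if "x < 1" "0 < t" "t < 1" for t
  proof (cases "x \<ge> 0")
    case True
    then have "x * t \<le> x * 1"
      using that by (intro mult_left_mono) auto
    with that show ?thesis by simp
  next
    case False
    with that have "x * t < 0" by (simp add: mult_neg_pos)
    then show ?thesis by simp
  qed
  from cond consider
      (A) "x \<ge> 0" "p1 < q1 + 1 \<or> x < 1 \<and> p1 = q1 + 1" "\<And>n. pochhammer_list a1 n / pochhammer_list b1 n > 0"
    | (B) "x < 1" "p1 = q1 + 1" "\<And>a. a \<in> set (remove1 (Max (set a1)) a1) \<Longrightarrow> a > 0"
        "\<And>t. t \<in> {0..1} \<Longrightarrow> v_fun (remove1 (Max (set a1)) a1) b1 t \<ge> 0"
    | (C) "p1 = q1" "\<And>a. a \<in> set a1 \<Longrightarrow> a > 0" "\<And>t. t \<in> {0..1} \<Longrightarrow> v_fun a1 b1 t \<ge> 0"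
    | (D) k s where "q1 = p1 + 1" "\<And>a. a \<in> set a1 \<Longrightarrow> a > 0" "k < q1" "s < q1"
        "(a1 @ [3/2]) ! k \<le> min 1 (b1 ! s - 1)"
        "\<And>t. t \<in> {0..1} \<Longrightarrow> v_fun (remove_nth k (a1 @ [3/2])) (remove_nth s b1) t \<ge> 0"
    unfolding Let_def by blast
  then show ?thesis
  proof cases
    case A
    have series: "eval_fps (fps_hypergeo (map of_real a1) (map of_real b1) 1) (of_real (x * t) :: complex) \<in> \<real>\<^sub>\<ge>\<^sub>0"
      if "t > 0" "p1 \<le> q1 \<or> t < 1" for t
      using A that len xt[of t] by (intro hypergeo_series_nonneg_of_coeffs) auto
    have "norm (of_real (x * t) :: complex) < 1" if "p1 = q1 + 1" "0 < t" "t < 1" for t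
      unfolding norm_of_real using A(1,2) xt[of t] that by simp
    with series show ?thesis
      using len by (auto simp: hypergeo_def)
  next
    case B
    have "a1 \<noteq> []"
      using B len by auto
    then have "Max (set a1) \<in> set a1"
      by (intro Max_in) auto
    then have "mset a1 = add_mset (Max (set a1)) (mset (remove1 (Max (set a1)) a1))"
      and "length (remove1 (Max (set a1)) a1) = length b1"
      using B len by (auto simp: length_remove1)
    with B xt show ?thesis
      by (auto intro!: hypergeo_slit_nonneg[where as = "remove1 (Max (set a1)) a1"] simp del: of_real_mult)
  next
    case C
    then show ?thesis
      using hypergeo_confluent_nonneg[of a1 b1] len by (auto simp: hypergeo_def simp del: of_real_mult)
  next
    case D
    have "v_fun (a1 @ [3/2, 2]) (b1 @ [1]) t \<ge> 0" if "t \<in> {0..1}" for t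
      using extended_v_fun_nonneg[OF _ _ _ D(5) D(6)[OF that] that] D(1,3,4) len by simp
    from hypergeo_squared_sinc_nonneg[OF _ D(2) this] show ?thesis
      using D(1) len by (auto simp: hypergeo_def simp del: of_real_mult)
  qed
qed

end
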